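(* Let $N$ be an odd positive integer and let $z_1,\dots,z_N \in \mathbb{C}$ be pairwise distinct points, with configuration matrix $A \in \mathbb{C}^{N \times N}$. Then $0$ is an eigenvalue of $A$, and hence there exists a nonzero strength vector $\vec{\Gamma} = (\Gamma_1,\dots,\Gamma_N)^T \in \mathbb{C}^N$ for which the configuration $\{z_1,\dots,z_N\}$ is a fixed equilibrium of the system $$\dot{z}_\alpha^{*} = \frac{1}{2\pi i}\sum_{\beta \neq \alpha} \frac{\Gamma_\beta}{z_\alpha - z_\beta}, \qquad \alpha = 1,\dots,N.$$
   Context: Here $z^*$ denotes the complex conjugate of $z$. A configuration is a collection of pairwise distinct points $z_1,\dots,z_N$ in the complex plane. Its configuration matrix is the skew-symmetric matrix $A = (a_{\alpha\beta}) \in \mathbb{C}^{N\times N}$ with $a_{\alpha\alpha} = 0$ and $a_{\alpha\beta} = \frac{1}{z_\alpha - z_\beta}$ for $\alpha \ne \beta$. Given a strength vector $\vec{\Gamma} \in \mathbb{C}^N$, the configuration is a fixed equilibrium if the constant functions $z_\alpha(t) \equiv z_\alpha$ solve the system, i.e. $\dot z_\alpha^{*} = 0$ for every $\alpha$, i.e. $\sum_{\beta \ne \alpha} \frac{\Gamma_\beta}{z_\alpha - z_\beta} = 0$ for every $\alpha = 1,\dots,N$. *)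

theory Defs
  imports Complex_Main "Jordan_Normal_Form.Char_Poly"
begin

text \<open>The points of a configuration are indexed by \<open>0, \<dots>, N - 1\<close>, following the
  indexing of vectors and matrices.\<close>

definition configuration :: "nat \<Rightarrow> (nat \<Rightarrow> complex) \<Rightarrow> bool" where
  "configuration N z \<longleftrightarrow> inj_on z {..<N}"

definition configuration_matrix :: "nat \<Rightarrow> (nat \<Rightarrow> complex) \<Rightarrow> complex mat" where
  "configuration_matrix N z =
     mat N N (\<lambda>(\<alpha>, \<beta>). if \<alpha> = \<beta> then 0 else 1 / (z \<alpha> - z \<beta>))"

text \<open>The right-hand side of the equations of motion, i.e. the complex conjugate of the
  velocity of the point \<open>\<alpha>\<close>.\<close>

definition conj_velocity :: "nat \<Rightarrow> complex vec \<Rightarrow> (nat \<Rightarrow> complex) \<Rightarrow> nat \<Rightarrow> complex" where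
  "conj_velocity N \<Gamma> z \<alpha> =
     1 / (2 * complex_of_real pi * \<i>) * (\<Sum>\<beta>\<in>{..<N} - {\<alpha>}. \<Gamma> $ \<beta> / (z \<alpha> - z \<beta>))"

text \<open>The phase space consists of pairwise distinct points; outside of it the
  right-hand side is meaningless (division by zero).\<close>

definition vortex_solution ::
    "nat \<Rightarrow> complex vec \<Rightarrow> (real \<Rightarrow> nat \<Rightarrow> complex) \<Rightarrow> bool" where
  "vortex_solution N \<Gamma> Z \<longleftrightarrow>
     (\<forall>t. configuration N (Z t) \<and>
       (\<forall>\<alpha><N. \<exists>v. ((\<lambda>s. Z s \<alpha>) has_vector_derivative v) (at t) \<and>
               cnj v = conj_velocity N \<Gamma> (Z t) \<alpha>))"

definition fixed_equilibrium :: "nat \<Rightarrow> complex vec \<Rightarrow> (nat \<Rightarrow> complex) \<Rightarrow> bool" where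
  "fixed_equilibrium N \<Gamma> z \<longleftrightarrow> vortex_solution N \<Gamma> (\<lambda>_. z)"

lemma fixed_equilibrium_iff:
  "fixed_equilibrium N \<Gamma> z \<longleftrightarrow>
     configuration N z \<and> (\<forall>\<alpha><N. (\<Sum>\<beta>\<in>{..<N} - {\<alpha>}. \<Gamma> $ \<beta> / (z \<alpha> - z \<beta>)) = 0)"
proof -
  have "v = 0" if "((\<lambda>s::real. c) has_vector_derivative v) (at t)" for c v :: complex and t
  proof -
    have "(\<lambda>x::real. x *\<^sub>R v) = (\<lambda>_. 0)"
      using that has_derivative_unique[OF _ has_derivative_const]
      unfolding has_vector_derivative_def by blast
    then show ?thesis
      by (metis scaleR_one)
  qed
  then have "(\<exists>v. ((\<lambda>s::real. c) has_vector_derivative v) (at t) \<and> cnj v = w) \<longleftrightarrow> w = 0"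
    for c w :: complex and t
    by (metis complex_cnj_zero has_vector_derivative_const)
  then show ?thesis
    unfolding fixed_equilibrium_def vortex_solution_def conj_velocity_def by simp
qed

end

theory Submission
  imports Defs
begin

text \<open>A skew-symmetric matrix of odd size is singular, because transposition preserves the
  determinant while negation multiplies it by \<open>(-1) ^ n = -1\<close>
  (\<open>det_odd_skew_symmetric\<close>). The configuration matrix is skew-symmetric, so it has a
  nonzero kernel vector. By \<open>configuration_matrix_mult_vec\<close> the kernel equations are
  exactly the equilibrium equations, so this one vector is both an eigenvector for 0 and the
  required strength vector.\<close>

lemma det_odd_skew_symmetric:
  fixes A :: "'a :: {idom, ring_char_0} mat"
  assumes A: "A \<in> carrier_mat n n" and skew: "transpose_mat A = - A" and "odd n"
  shows "det A = 0"
proof -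
  \<comment> \<open>Writing negation as a scalar multiple lets \<open>det_smult\<close> extract one
    sign per column.\<close>
  have "- A = (-1) \<cdot>\<^sub>m A"
    by (intro eq_matI) auto
  then have "det (- A) = (-1) ^ n * det A"
    using A by (metis carrier_matD(2) det_smult)
  then have "det (- A) = - det A"
    using \<open>odd n\<close> by simp
  then have "det A = - det A"
    using det_transpose[OF A] skew by simp
  \<comment> \<open>Characteristic 0 enters here: \<open>2 * det A = 0\<close> forces
    \<open>det A = 0\<close>.\<close>
  then show ?thesis
    by simp
qed

lemma configuration_matrix_carrier [simp]: "configuration_matrix N z \<in> carrier_mat N N"
  by (simp add: configuration_matrix_def)

lemma transpose_configuration_matrix:
  "transpose_mat (configuration_matrix N z) = - configuration_matrix N z"
proof -
  \<comment> \<open>This also covers coinciding values of \<open>z\<close>, where both sides are 0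
    since division by zero yields 0.\<close>
  have *: "1 / (z \<beta> - z \<alpha>) = - (1 / (z \<alpha> - z \<beta>))" for \<alpha> \<beta>
    by (metis minus_diff_eq minus_divide_right)
  show ?thesis
    by (intro eq_matI) (auto simp: configuration_matrix_def intro: *)
qed

text \<open>The zero diagonal removes the self-interaction term, which turns a matrix row into the
  sum in the equations of motion.\<close>

lemma configuration_matrix_mult_vec:
  assumes "\<Gamma> \<in> carrier_vec N" and "\<alpha> < N"
  shows "(configuration_matrix N z *\<^sub>v \<Gamma>) $ \<alpha> = (\<Sum>\<beta>\<in>{..<N} - {\<alpha>}. \<Gamma> $ \<beta> / (z \<alpha> - z \<beta>))"
proof -
  have "(configuration_matrix N z *\<^sub>v \<Gamma>) $ \<alpha> =
      (\<Sum>\<beta>\<in>{..<N}. if \<alpha> = \<beta> then 0 else \<Gamma> $ \<beta> / (z \<alpha> - z \<beta>))"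
    using assms unfolding configuration_matrix_def lessThan_atLeast0
    by (auto simp: scalar_prod_def intro!: sum.cong)
  also have "\<dots> = (\<Sum>\<beta>\<in>{..<N} - {\<alpha>}. \<Gamma> $ \<beta> / (z \<alpha> - z \<beta>))"
    by (rule sum.mono_neutral_cong_right) auto
  finally show ?thesis .
qed

theorem theorem2:
  fixes N :: nat and z :: "nat \<Rightarrow> complex"
  assumes "odd N" and "configuration N z"
  shows "eigenvalue (configuration_matrix N z) 0 \<and>
    (\<exists>\<Gamma> \<in> carrier_vec N. \<Gamma> \<noteq> 0\<^sub>v N \<and> fixed_equilibrium N \<Gamma> z)"
proof -
  let ?A = "configuration_matrix N z"
  have "det ?A = 0"
    using det_odd_skew_symmetric transpose_configuration_matrix \<open>odd N\<close>
    by (metis configuration_matrix_carrier)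
  then obtain \<Gamma> where \<Gamma>: "\<Gamma> \<in> carrier_vec N" "\<Gamma> \<noteq> 0\<^sub>v N" and ker: "?A *\<^sub>v \<Gamma> = 0\<^sub>v N"
    using det_0_iff_vec_prod_zero[OF configuration_matrix_carrier] by blast
  have "(\<Sum>\<beta>\<in>{..<N} - {\<alpha>}. \<Gamma> $ \<beta> / (z \<alpha> - z \<beta>)) = 0" if "\<alpha> < N" for \<alpha>
    using configuration_matrix_mult_vec[OF \<Gamma>(1) that, of z] ker that by simp
  \<comment> \<open>\<open>fixed_equilibrium_iff\<close> reduces the differential equation for
    constant motions to these vanishing sums and the distinctness of the points.\<close>
  then have "fixed_equilibrium N \<Gamma> z"
    using \<open>configuration N z\<close> by (simp add: fixed_equilibrium_iff)
  moreover have "dim_row ?A = N"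
    by (simp add: configuration_matrix_def)
  \<comment> \<open>This recasts the kernel equation in the form
    \<open>A *\<^sub>v v = k \<cdot>\<^sub>v v\<close> of \<open>eigenvector_def\<close>, with
    \<open>k = 0\<close>.\<close>
  moreover have "0 \<cdot>\<^sub>v \<Gamma> = 0\<^sub>v N"
    using \<Gamma> by auto
  ultimately have "eigenvector ?A \<Gamma> 0" and "fixed_equilibrium N \<Gamma> z"
    using \<Gamma> ker by (simp_all add: eigenvector_def)
  then show ?thesis
    using \<Gamma> unfolding eigenvalue_def by blast
qed

end
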